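(* For all integers $n\ge 0$ and $l\ge 0$, $$B_n^{2l+1}=\frac{1}{2^{5l}}\sum_{0\le s\le l}(-1)^s\binom{2l+1}{s}B_{(2(l-s)+1)n}.$$
   Context: The balancing numbers $(B_n)_{n\ge 0}$ are defined by $B_0=0$, $B_1=1$ and $B_n=6B_{n-1}-B_{n-2}$ for $n\ge 2$. The identity is between rational numbers; $B_n^{2l+1}$ denotes the $(2l+1)$-th power of $B_n$. *)

theory Defs
  imports Complex_Main
begin

text \<open>The recurrence is taken over the integers, since natural-number subtraction truncates.\<close>

fun balancing :: "nat \<Rightarrow> int" where
  "balancing 0 = 0"
| "balancing (Suc 0) = 1"
| "balancing (Suc (Suc n)) = 6 * balancing (Suc n) - balancing n"

end

theory Submission
  imports Defs
begin

text \<open>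
  The roots \<open>\<alpha>, \<beta> = 3 \<plusminus> 2 \<surd>2\<close> of \<open>t\<^sup>2 = 6 t - 1\<close> satisfy \<open>\<alpha> \<beta> = 1\<close> and
  \<open>\<alpha> - \<beta> = 4 \<surd>2\<close>, and Binet's formula reads \<open>4 \<surd>2 B\<^sub>n = \<alpha>\<^sup>n - \<beta>\<^sup>n\<close>
  (\<open>balancing_Binet\<close>). Raise it to the odd power \<open>2 l + 1\<close>. In the binomial expansion of
  \<open>(x - y)\<close> to that power, the terms with indices \<open>s\<close> and \<open>2 l + 1 - s\<close> have equal
  binomial coefficients and opposite signs, and have the factor \<open>(x y)\<^sup>s\<close> in common
  (\<open>odd_power_diff_expansion\<close>). For \<open>x = \<alpha>\<^sup>n\<close>, \<open>y = \<beta>\<^sup>n\<close> that factor is \<open>1\<close>,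
  so each such pair is by Binet's formula again \<open>4 \<surd>2\<close> times a balancing number. Cancelling one
  factor \<open>4 \<surd>2\<close> leaves \<open>(4 \<surd>2)\<close> to the power \<open>2 l\<close>, which is \<open>32\<close> to the power
  \<open>l\<close>, on the left. The resulting identity involves integers only, so it passes
  from the reals to the rationals.
\<close>

text \<open>
  The binomial expansion folded about its middle: an odd exponent gives an even number of
  terms, so no term is left unpaired.
\<close>

lemma odd_power_diff_expansion:
  fixes x y :: "'a::comm_ring_1"
  shows "(x - y) ^ (2 * l + 1) =
    (\<Sum>s = 0..l. (- 1) ^ s * of_nat ((2 * l + 1) choose s) * (x * y) ^ s *
      (x ^ (2 * (l - s) + 1) - y ^ (2 * (l - s) + 1)))"
proof -
  let ?N = "2 * l + 1"
  define t where "t k = of_nat (?N choose k) * (- y) ^ k * x ^ (?N - k)" for k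
  have pair: "t s + t (?N - s) = (- 1) ^ s * of_nat (?N choose s) * (x * y) ^ s *
      (x ^ (2 * (l - s) + 1) - y ^ (2 * (l - s) + 1))" if "s \<le> l" for s
  proof -
    define d where "d = 2 * (l - s) + 1"
    have d: "?N - s = s + d" "?N - (s + d) = s" "odd d"
      using that by (auto simp: d_def)
    have choose: "?N choose (s + d) = ?N choose s"
      using binomial_symmetric[of s ?N] that d(1) by simp
    have "t s = (- 1) ^ s * of_nat (?N choose s) * (x * y) ^ s * x ^ d"
      unfolding t_def d(1) by (subst power_minus) (simp add: power_add power_mult_distrib algebra_simps)
    moreover have "t (s + d) = - ((- 1) ^ s * of_nat (?N choose s) * (x * y) ^ s * y ^ d)"
      unfolding t_def d(2) choose using d(3)
      by (subst power_minus) (simp add: power_add power_mult_distrib algebra_simps)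
    ultimately show ?thesis
      unfolding d(1) d_def[symmetric] by (simp add: algebra_simps)
  qed
  have "(x - y) ^ ?N = (\<Sum>k\<le>?N. t k)"
    using binomial_ring[of "- y" x ?N] by (simp add: t_def)
  also have "\<dots> = (\<Sum>k\<in>{0..l}. t k) + (\<Sum>k\<in>{l+1..?N}. t k)"
  proof -
    have "{..?N} = {0..l} \<union> {l+1..?N}" by auto
    then show ?thesis by (simp only:) (rule sum.union_disjoint; auto)
  qed
  also have "(\<Sum>k\<in>{l+1..?N}. t k) = (\<Sum>s\<in>{0..l}. t (?N - s))"
    by (rule sum.reindex_bij_witness[of _ "\<lambda>s. ?N - s" "\<lambda>s. ?N - s"]) auto
  finally show ?thesis
    using pair by (simp add: sum.distrib[symmetric])
qed

lemma balancing_Binet: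
  "4 * sqrt 2 * of_int (balancing n) = (3 + 2 * sqrt 2) ^ n - (3 - 2 * sqrt 2) ^ n"
proof (induction n rule: balancing.induct)
  case (3 n)
  have root: "r ^ Suc (Suc n) = 6 * r ^ Suc n - r ^ n" if "r * r = 6 * r - 1" for r :: real
  proof -
    have "r ^ Suc (Suc n) = (r * r) * r ^ n" by simp
    then show ?thesis unfolding that by (simp add: algebra_simps)
  qed
  have "(3 + 2 * sqrt 2) * (3 + 2 * sqrt 2) = 6 * (3 + 2 * sqrt 2) - 1"
    and "(3 - 2 * sqrt 2) * (3 - 2 * sqrt 2) = 6 * (3 - 2 * sqrt 2) - 1"
    by (simp_all add: algebra_simps)
  note roots = root[OF this(1)] root[OF this(2)]
  have "4 * sqrt 2 * of_int (balancing (Suc (Suc n))) =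
      6 * (4 * sqrt 2 * of_int (balancing (Suc n))) - 4 * sqrt 2 * of_int (balancing n)"
    by (simp add: algebra_simps)
  then show ?case
    unfolding 3 roots by (simp only: algebra_simps)
qed simp_all

lemma balancing_odd_power:
  "32 ^ l * balancing n ^ (2 * l + 1) =
    (\<Sum>s = 0..l. (- 1) ^ s * int ((2 * l + 1) choose s) * balancing ((2 * (l - s) + 1) * n))"
    (is "?L = ?R")
proof -
  define c where "c = 4 * sqrt 2"
  define x y where "x = (3 + 2 * sqrt 2) ^ n" and "y = (3 - 2 * sqrt 2) ^ n"
  have c: "c \<noteq> 0" "c ^ (2 * l + 1) = c * 32 ^ l"
    by (simp_all add: c_def power_mult power_mult_distrib)
  have xy: "x * y = 1"
    by (simp add: x_def y_def power_mult_distrib[symmetric] algebra_simps)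
  have Binet: "x ^ m - y ^ m = c * of_int (balancing (m * n))" for m
    using balancing_Binet[of "m * n"]
    by (simp add: c_def x_def y_def power_mult[symmetric] mult.commute[of n m])
  have "c * of_int ?L = (c * of_int (balancing n)) ^ (2 * l + 1)"
    unfolding power_mult_distrib c(2) by simp
  also have "\<dots> = (x - y) ^ (2 * l + 1)"
    using Binet[of 1] by simp
  also have "\<dots> = c * of_int ?R"
    unfolding odd_power_diff_expansion xy Binet
    by (simp add: sum_distrib_left algebra_simps)
  finally have "real_of_int ?L = of_int ?R"
    using c(1) by simp
  then show ?thesis
    by (simp only: of_int_eq_iff)
qed

theorem theorem1:
  fixes n l :: nat
  shows "(of_int (balancing n) :: rat) ^ (2 * l + 1) =
    1 / 2 ^ (5 * l) *
      (\<Sum>s = 0..l. (- 1) ^ s * of_nat ((2 * l + 1) choose s) *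
        of_int (balancing ((2 * (l - s) + 1) * n)))"
proof -
  have "(2 :: rat) ^ (5 * l) = 32 ^ l"
    by (simp add: power_mult)
  moreover have "(32 :: rat) ^ l * of_int (balancing n) ^ (2 * l + 1) =
      (\<Sum>s = 0..l. (- 1) ^ s * of_nat ((2 * l + 1) choose s) *
        of_int (balancing ((2 * (l - s) + 1) * n)))"
    using arg_cong[OF balancing_odd_power[of l n], of "of_int :: int \<Rightarrow> rat"] by simp
  ultimately show ?thesis
    by (simp add: field_simps)
qed

end
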